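(* (i) The Helmholtz equation for the wave function $\psi$ on the hyperbolic plane reads $$\Delta_{\mathbb{H}}\psi+k_{\mathbb{H}}^2\psi=0,$$ where $k_{\mathbb{H}}^2=\lambda^2+\frac14$ $(\lambda\in\mathbb{R})$. (ii) The geometrical approximation of the wave function $\psi$ (for $|\lambda|\to\infty$), written in terms of the Beltrami coordinates, reads $$\psi_\pm(\lambda,u)=C(\lambda)\,e^{u/2}\,e^{\mp i\lambda u}\qquad(\lambda\in\mathbb{R};\ u\ge 0).$$
   Context: The setting is the geometrical optics of the refractive index $n(x,y)=1/y$ in the half-plane $y>0$, whose associated metric is the hyperbolic one, $\mathrm{d}s^2=(\mathrm{d}x^2+\mathrm{d}y^2)/y^2$, with Laplace–Beltrami operator $$\Delta_{\mathbb{H}}=y^2\left(\frac{\partial^2}{\partial x^2}+\frac{\partial^2}{\partial y^2}\right).$$ The Beltrami coordinates $(u,v)$ are coordinates on the Beltrami pseudosphere (a surface of revolution in $\mathbb{R}^3$ of constant curvature $-1$), in which the first fundamental form is $\mathrm{d}u^2+e^{-2u}\mathrm{d}v^2$, $u\ge0$. A horocycle region of the hyperbolic plane (a disk bounded by a circle tangent to the boundary at a point $b$, the normal) is mapped locally isometrically into the pseudosphere; the curves $u=\text{const.}$ correspond to horocycles with the same normal $b$, and the wave functions considered depend on $u$ only. On the pseudosphere the Helmholtz equation is $\Delta_{\mathcal{B}}\psi+k_{\mathbb{H}}^2\psi=0$, with $\Delta_{\mathcal{B}}$ the Laplace–Beltrami operator of the metric $\mathrm{d}u^2+e^{-2u}\mathrm{d}v^2$.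 By the geometrical approximation of $\psi$ is meant the leading term, as $|\lambda|\to\infty$, of the asymptotic expansion of $\psi$; this term has the form of a factor depending on $\lambda$ only times $A\,e^{(\frac12-i\lambda)\Phi}$, with amplitude $A$ and phase $\Phi$ independent of $\lambda$ and determined by the equations obtained on substituting it in the Helmholtz equation and equating to zero the coefficients of the powers of $i\lambda$. $C(\lambda)$ denotes a factor that does not depend on $u$; the signs $\pm$ correspond to the two phases $\Phi=\pm u+\text{const.}$ *)

theory Defs
  imports "HOL-Analysis.Analysis" "HOL-Library.Landau_Symbols"
    "HOL-Computational_Algebra.Polynomial"
begin

type_synonym point = "real \<times> real"

text \<open>Partial derivatives are taken along the coordinate slices of the domain \<open>U\<close>, so
  they are one-sided at boundary points that belong to \<open>U\<close>.\<close>

definition slice1 :: "point set \<Rightarrow> point \<Rightarrow> real set" where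
  "slice1 U p = {t. (t, snd p) \<in> U}"

definition slice2 :: "point set \<Rightarrow> point \<Rightarrow> real set" where
  "slice2 U p = {t. (fst p, t) \<in> U}"

definition partial1 :: "point set \<Rightarrow> (point \<Rightarrow> 'a::real_normed_vector) \<Rightarrow> point \<Rightarrow> 'a" where
  "partial1 U f p = vector_derivative (\<lambda>t. f (t, snd p)) (at (fst p) within slice1 U p)"

definition partial2 :: "point set \<Rightarrow> (point \<Rightarrow> 'a::real_normed_vector) \<Rightarrow> point \<Rightarrow> 'a" where
  "partial2 U f p = vector_derivative (\<lambda>t. f (fst p, t)) (at (snd p) within slice2 U p)"

definition C1_on :: "point set \<Rightarrow> (point \<Rightarrow> 'a::real_normed_vector) \<Rightarrow> bool" where
  "C1_on U f \<longleftrightarrow>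
     continuous_on U f \<and>
     (\<forall>p\<in>U. (\<lambda>t. f (t, snd p)) differentiable (at (fst p) within slice1 U p) \<and>
            (\<lambda>t. f (fst p, t)) differentiable (at (snd p) within slice2 U p)) \<and>
     continuous_on U (partial1 U f) \<and> continuous_on U (partial2 U f)"

definition C2_on :: "point set \<Rightarrow> (point \<Rightarrow> 'a::real_normed_vector) \<Rightarrow> bool" where
  "C2_on U f \<longleftrightarrow> C1_on U f \<and> C1_on U (partial1 U f) \<and> C1_on U (partial2 U f)"

text \<open>Laplace--Beltrami operator
  \<open>(det g)\<^sup>-\<^sup>1\<^sup>/\<^sup>2 \<Sum>\<^sub>i\<^sub>j \<partial>\<^sub>i ((det g)\<^sup>1\<^sup>/\<^sup>2 g\<^sup>i\<^sup>j \<partial>\<^sub>j f)\<close> of the metric with first fundamental form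
  \<open>E dp\<^sub>1\<^sup>2 + 2 F dp\<^sub>1 dp\<^sub>2 + G dp\<^sub>2\<^sup>2\<close>, given as the triple \<open>(E, F, G)\<close>.\<close>

type_synonym metric = "(point \<Rightarrow> real) \<times> (point \<Rightarrow> real) \<times> (point \<Rightarrow> real)"

definition laplace_beltrami ::
    "point set \<Rightarrow> metric \<Rightarrow> (point \<Rightarrow> complex) \<Rightarrow> point \<Rightarrow> complex" where
  "laplace_beltrami U g f = (case g of (E, F, G) \<Rightarrow>
     let W = (\<lambda>q. sqrt (E q * G q - (F q)\<^sup>2)) in
     (\<lambda>p. (partial1 U (\<lambda>q. (G q *\<^sub>R partial1 U f q - F q *\<^sub>R partial2 U f q) /\<^sub>R W q) p
         + partial2 U (\<lambda>q. (E q *\<^sub>R partial2 U f q - F q *\<^sub>R partial1 U f q) /\<^sub>R W q) p)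
        /\<^sub>R W p))"

definition helmholtz :: "point set \<Rightarrow> metric \<Rightarrow> real \<Rightarrow> (point \<Rightarrow> complex) \<Rightarrow> bool" where
  "helmholtz U g k2 \<psi> \<longleftrightarrow>
     (\<forall>p\<in>U. laplace_beltrami U g \<psi> p + of_real k2 * \<psi> p = 0)"

definition optical_metric :: "(point \<Rightarrow> real) \<Rightarrow> metric" where
  "optical_metric n = ((\<lambda>p. (n p)\<^sup>2), (\<lambda>p. 0), (\<lambda>p. (n p)\<^sup>2))"

definition half_plane :: "point set" where
  "half_plane = {(x, y). y > 0}"

definition hyperbolic_metric :: metric where
  "hyperbolic_metric = optical_metric (\<lambda>(x, y). 1 / y)"

definition hyperbolic_laplacian :: "(point \<Rightarrow> complex) \<Rightarrow> point \<Rightarrow> complex" where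
  "hyperbolic_laplacian \<psi> p = (snd p)\<^sup>2 *\<^sub>R
     (partial1 half_plane (partial1 half_plane \<psi>) p
    + partial2 half_plane (partial2 half_plane \<psi>) p)"

definition wave_function :: "real \<Rightarrow> (point \<Rightarrow> complex) \<Rightarrow> bool" where
  "wave_function lam \<psi> \<longleftrightarrow>
     C2_on half_plane \<psi> \<and> helmholtz half_plane hyperbolic_metric (lam\<^sup>2 + 1/4) \<psi>"

text \<open>Domain of the Beltrami coordinates \<open>(u, v)\<close>. Since only local isometry with the
  pseudosphere matters, \<open>v\<close> is not taken modulo a period.\<close>

definition beltrami_domain :: "point set" where
  "beltrami_domain = {(u, v). u \<ge> 0}"

definition beltrami_metric :: metric where
  "beltrami_metric = ((\<lambda>p. 1), (\<lambda>p. 0), (\<lambda>(u, v). exp (- 2 * u)))"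

text \<open>A normal is a boundary point: \<open>Some b\<close> for \<open>b\<close> on the real axis, \<open>None\<close> for the point
  at infinity. The horocycles with a given normal are the level curves of \<open>horo_height\<close>: the
  circles tangent to the real axis at \<open>b\<close>, respectively the lines \<open>y = const.\<close>. The horocycle
  region of parameter \<open>h > 0\<close> is \<open>horo_height \<ge> h\<close>; for \<open>Some b\<close> it is the disk of Euclidean
  radius \<open>1 / (2 h)\<close> tangent at \<open>b\<close>.\<close>

definition horo_height :: "real option \<Rightarrow> point \<Rightarrow> real" where
  "horo_height b = (\<lambda>(x, y). case b of None \<Rightarrow> y | Some c \<Rightarrow> y / ((x - c)\<^sup>2 + y\<^sup>2))"

definition horo_coordinate :: "real option \<Rightarrow> real \<Rightarrow> point \<Rightarrow> real" where
  "horo_coordinate b h p = ln (horo_height b p / h)"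

definition horocyclic_wave :: "real option \<Rightarrow> real \<Rightarrow> real \<Rightarrow> point \<Rightarrow> complex" where
  "horocyclic_wave b h lam p = exp ((1/2 - \<i> * of_real lam) * of_real (horo_coordinate b h p))"

text \<open>Beltrami coordinates on the horocycle region: \<open>h (v + i e\<^sup>u)\<close> parametrises \<open>y \<ge> h\<close>, and
  the hyperbolic isometry \<open>z \<mapsto> c - 1/z\<close> moves the normal from infinity to \<open>c\<close>.\<close>

definition beltrami_point :: "real option \<Rightarrow> real \<Rightarrow> point \<Rightarrow> complex" where
  "beltrami_point b h = (\<lambda>(u, v). let z = of_real h * Complex v (exp u) in
     case b of None \<Rightarrow> z | Some c \<Rightarrow> of_real c - 1 / z)"

definition beltrami_chart :: "real option \<Rightarrow> real \<Rightarrow> point \<Rightarrow> point" where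
  "beltrami_chart b h p = (Re (beltrami_point b h p), Im (beltrami_point b h p))"

text \<open>\<open>w lam u\<close> is the wave function \<open>\<psi> lam\<close> written in Beltrami coordinates; it depends on \<open>u\<close> only.\<close>

definition in_beltrami_coordinates ::
    "real option \<Rightarrow> real \<Rightarrow> (real \<Rightarrow> point \<Rightarrow> complex) \<Rightarrow> (real \<Rightarrow> real \<Rightarrow> complex) \<Rightarrow> bool" where
  "in_beltrami_coordinates b h \<psi> w \<longleftrightarrow>
     (\<forall>lam. \<forall>(u, v)\<in>beltrami_domain. \<psi> lam (beltrami_chart b h (u, v)) = w lam u)"

definition geometrical_term ::
    "(real \<Rightarrow> real) \<Rightarrow> (real \<Rightarrow> complex) \<Rightarrow> real \<Rightarrow> real \<Rightarrow> complex" where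
  "geometrical_term \<Phi> A lam u = A u * exp ((1/2 - \<i> * of_real lam) * of_real (\<Phi> u))"

text \<open>\<open>P p\<close> is the polynomial in \<open>i lam\<close> multiplying the exponential when the term is substituted
  in the Helmholtz equation on the pseudosphere. It is unique, being prescribed at all \<open>i lam\<close>.\<close>

definition substitution_polynomial ::
    "(real \<Rightarrow> real) \<Rightarrow> (real \<Rightarrow> complex) \<Rightarrow> (point \<Rightarrow> complex poly) \<Rightarrow> bool" where
  "substitution_polynomial \<Phi> A P \<longleftrightarrow>
     (\<forall>lam. \<forall>p\<in>beltrami_domain.
        laplace_beltrami beltrami_domain beltrami_metric (\<lambda>q. geometrical_term \<Phi> A lam (fst q)) p
        + of_real (lam\<^sup>2 + 1/4) * geometrical_term \<Phi> A lam (fst p)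
        = poly (P p) (\<i> * of_real lam) * exp ((1/2 - \<i> * of_real lam) * of_real (\<Phi> (fst p))))"

definition geometrical_equations :: "(real \<Rightarrow> real) \<Rightarrow> (real \<Rightarrow> complex) \<Rightarrow> bool" where
  "geometrical_equations \<Phi> A \<longleftrightarrow>
     (\<exists>P. substitution_polynomial \<Phi> A P \<and> (\<forall>p\<in>beltrami_domain. \<forall>j. coeff (P p) j = 0))"

text \<open>\<open>T\<close> is the geometrical approximation, with phase \<open>\<Phi>\<close>, of the wave function \<open>w\<close>. The filter
  \<open>at_infinity\<close> on the reals is the limit of large absolute value of \<open>lam\<close>.\<close>

definition geometrical_approximation ::
    "(real \<Rightarrow> real \<Rightarrow> complex) \<Rightarrow> (real \<Rightarrow> real) \<Rightarrow> (real \<Rightarrow> real \<Rightarrow> complex) \<Rightarrow> bool" where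
  "geometrical_approximation w \<Phi> T \<longleftrightarrow>
     (\<forall>u\<ge>0. (\<lambda>lam. w lam u) \<sim>[at_infinity] (\<lambda>lam. T lam u)) \<and>
     (\<exists>c A. C2_on beltrami_domain (\<lambda>p. \<Phi> (fst p)) \<and> C2_on beltrami_domain (\<lambda>p. A (fst p)) \<and>
        (\<exists>u\<ge>0. A u \<noteq> 0) \<and> geometrical_equations \<Phi> A \<and>
        (\<forall>lam. \<forall>u\<ge>0. T lam u = c lam * geometrical_term \<Phi> A lam u))"

lemma horo_coordinate_beltrami_chart:
  assumes "h > 0"
  shows "horo_coordinate b h (beltrami_chart b h (u, v)) = u"
proof (cases b)
  case None
  then show ?thesis using assms
    by (simp add: horo_coordinate_def horo_height_def beltrami_chart_def beltrami_point_def)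
next
  case (Some c)
  define z where "z = of_real h * Complex v (exp u)"
  have im: "Im z = h * exp u" by (simp add: z_def)
  have pos: "(Re z)\<^sup>2 + (Im z)\<^sup>2 > 0"
    using assms by (simp add: im add_nonneg_pos)
  have "(- (Re z / ((Re z)\<^sup>2 + (Im z)\<^sup>2)))\<^sup>2 + (Im z / ((Re z)\<^sup>2 + (Im z)\<^sup>2))\<^sup>2
          = 1 / ((Re z)\<^sup>2 + (Im z)\<^sup>2)"
    using pos by (simp add: power_divide flip: add_divide_distrib) (simp add: power2_eq_square)
  then show ?thesis using assms pos Some
    by (simp add: horo_coordinate_def horo_height_def beltrami_chart_def beltrami_point_def
        Let_def im Re_divide Im_divide flip: z_def)
qed

lemma beltrami_chart_isometry:
  fixes b :: "real option" and h u v :: real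
  assumes "h > 0"
  defines "y \<equiv> Im (beltrami_point b h (u, v))"
  obtains X Y where
    "((\<lambda>t. beltrami_point b h (t, v)) has_vector_derivative X) (at u)"
    "((\<lambda>t. beltrami_point b h (u, t)) has_vector_derivative Y) (at v)"
    "y > 0" "(X \<bullet> X) / y\<^sup>2 = 1" "(X \<bullet> Y) / y\<^sup>2 = 0" "(Y \<bullet> Y) / y\<^sup>2 = exp (- 2 * u)"
proof -
  define z where "z = of_real h * Complex v (exp u)"
  define Dz where "Dz = (\<lambda>z'. case b of None \<Rightarrow> z' | Some c \<Rightarrow> z' / z\<^sup>2)"
  have im: "Im z = h * exp u" by (simp add: z_def)
  have z0: "z \<noteq> 0" using im assms(1) by force
  have Complex_eq: "of_real h * Complex a e = of_real h * (of_real a + \<i> * of_real e)" for a e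
    by (simp add: complex_eq_iff)
  have du: "((\<lambda>t. of_real h * Complex v (exp t)) has_vector_derivative \<i> * of_real (h * exp u)) (at u)"
    unfolding Complex_eq
    by (auto intro!: derivative_eq_intros has_vector_derivative_of_real
        simp: has_real_derivative_iff_has_vector_derivative[symmetric] algebra_simps)
  have dv: "((\<lambda>t. of_real h * Complex t (exp u)) has_vector_derivative of_real h) (at v)"
    unfolding Complex_eq
    by (auto intro!: derivative_eq_intros has_vector_derivative_of_real
        simp: has_real_derivative_iff_has_vector_derivative[symmetric] algebra_simps)
  have D: "((\<lambda>t. case b of None \<Rightarrow> g t | Some c \<Rightarrow> of_real c - 1 / g t)
             has_vector_derivative Dz g') (at a)"
    if g: "(g has_vector_derivative g') (at a)" "g a = z" for g g' a
  proof (cases b)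
    case None
    then show ?thesis using g by (simp add: Dz_def)
  next
    case (Some c)
    have "((\<lambda>w. of_real c - 1 / w) has_field_derivative 1 / z\<^sup>2) (at (g a))"
      using z0 g by (auto intro!: derivative_eq_intros simp: power2_eq_square field_simps)
    from field_vector_diff_chain_at[OF g(1) this] show ?thesis
      using Some by (simp add: Dz_def o_def)
  qed
  have y: "y = (case b of None \<Rightarrow> Im z | Some c \<Rightarrow> Im z / (cmod z)\<^sup>2)"
    by (cases b) (simp_all add: y_def beltrami_point_def Let_def Im_divide cmod_power2 flip: z_def)
  have Dz_eq: "Dz w = w * Dz 1" for w by (cases b) (simp_all add: Dz_def)
  have nDz: "cmod (Dz 1) = y / Im z"
    using im assms(1) by (cases b) (simp_all add: Dz_def y norm_divide norm_power)
  have y0: "y > 0" using im assms(1) z0 by (cases b) (simp_all add: y)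
  have *: "(Dz w \<bullet> Dz w') / y\<^sup>2 = (w \<bullet> w') / (h * exp u)\<^sup>2" for w w'
  proof -
    have "Dz w \<bullet> Dz w' = (w \<bullet> w') * (cmod (Dz 1))\<^sup>2"
      unfolding Dz_eq[of w] Dz_eq[of w'] cmod_power2
      by (simp add: inner_complex_def power2_eq_square algebra_simps)
    then show ?thesis unfolding nDz im using y0 by (simp add: power_divide)
  qed
  show thesis
  proof (rule that)
    show "((\<lambda>t. beltrami_point b h (t, v)) has_vector_derivative Dz (\<i> * of_real (h * exp u))) (at u)"
      unfolding beltrami_point_def Let_def split by (rule D[OF du]) (simp add: z_def)
    show "((\<lambda>t. beltrami_point b h (u, t)) has_vector_derivative Dz (of_real h)) (at v)"
      unfolding beltrami_point_def Let_def split by (rule D[OF dv]) (simp add: z_def)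
  qed (use y0 assms(1) in \<open>simp_all only: *\<close>,
       simp_all add: inner_complex_def power2_eq_square exp_minus field_simps
         flip: exp_double exp_add mult_2)
qed

end

theory Submission imports Defs begin

text \<open>The function \<open>F = horo_coordinate b h\<close> satisfies the eikonal equation \<open>|\<nabla>F| = 1\<close> and
  \<open>\<Delta> F = -1\<close> for the hyperbolic metric, so \<open>exp (s F)\<close> is an eigenfunction with eigenvalue
  \<open>s (s - 1)\<close>, which is \<open>- (lam\<^sup>2 + 1/4)\<close> for \<open>s = 1/2 - i lam\<close>; in Beltrami coordinates \<open>F = u\<close>.

  On functions of \<open>u\<close> alone the Laplacian of the pseudosphere is \<open>f'' - f'\<close>. Substituting the
  geometrical term, the coefficients of the powers of \<open>i lam\<close> amount to the eikonal equation
  \<open>A \<Phi>'\<^sup>2 = A\<close>, the transport equation \<open>2 A' \<Phi>' + A \<Phi>'' - A \<Phi>' = - A\<close>, and \<open>A'' = A'\<close>. They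
  imply that \<open>A\<close> has no zero, so \<open>\<Phi>' = \<sigma>\<close> is a constant sign and \<open>A\<close> is a multiple of
  \<open>exp ((1 - \<sigma>) u / 2)\<close>.\<close>

subsection \<open>Partial derivatives along slices\<close>

text \<open>\<open>vector_derivative\<close> is a choice, and the choice is unique only where the
  filter is non-trivial. This condition rules out isolated points of slices, so that any derivative
  found by calculus is the partial derivative.\<close>

definition slicewise_perfect :: "point set \<Rightarrow> bool" where
  "slicewise_perfect U \<longleftrightarrow>
     (\<forall>p\<in>U. at (fst p) within slice1 U p \<noteq> bot \<and> at (snd p) within slice2 U p \<noteq> bot)"

text \<open>Relational form of \<open>C1_on\<close>: the partials are explicit functions instead of
  chosen ones, so that product and chain rules compose and yield closed forms.\<close>

definition has_C1_partials ::
    "point set \<Rightarrow> (point \<Rightarrow> 'a::real_normed_vector) \<Rightarrow> (point \<Rightarrow> 'a) \<Rightarrow> (point \<Rightarrow> 'a) \<Rightarrow> bool" where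
  "has_C1_partials U f f1 f2 \<longleftrightarrow>
     continuous_on U f \<and> continuous_on U f1 \<and> continuous_on U f2 \<and>
     (\<forall>p\<in>U. ((\<lambda>t. f (t, snd p)) has_vector_derivative f1 p) (at (fst p) within slice1 U p) \<and>
            ((\<lambda>t. f (fst p, t)) has_vector_derivative f2 p) (at (snd p) within slice2 U p))"

lemma has_C1_partialsD:
  assumes "has_C1_partials U f f1 f2"
  shows "continuous_on U f" "continuous_on U f1" "continuous_on U f2"
    "\<And>x y. (x, y) \<in> U \<Longrightarrow> ((\<lambda>t. f (t, y)) has_vector_derivative f1 (x, y)) (at x within slice1 U (x, y))"
    "\<And>x y. (x, y) \<in> U \<Longrightarrow> ((\<lambda>t. f (x, t)) has_vector_derivative f2 (x, y)) (at y within slice2 U (x, y))"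
  using assms unfolding has_C1_partials_def by fastforce+

lemma has_C1_partialsI:
  assumes "continuous_on U f" "continuous_on U f1" "continuous_on U f2"
    "\<And>x y. (x, y) \<in> U \<Longrightarrow> ((\<lambda>t. f (t, y)) has_vector_derivative f1 (x, y)) (at x within slice1 U (x, y))"
    "\<And>x y. (x, y) \<in> U \<Longrightarrow> ((\<lambda>t. f (x, t)) has_vector_derivative f2 (x, y)) (at y within slice2 U (x, y))"
  shows "has_C1_partials U f f1 f2"
  using assms unfolding has_C1_partials_def by auto

lemma partial1_eq:
  assumes "slicewise_perfect U" "p \<in> U"
    "((\<lambda>t. f (t, snd p)) has_vector_derivative d) (at (fst p) within slice1 U p)"
  shows "partial1 U f p = d"
  using assms unfolding partial1_def slicewise_perfect_def by (blast intro: vector_derivative_within)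

lemma partial2_eq:
  assumes "slicewise_perfect U" "p \<in> U"
    "((\<lambda>t. f (fst p, t)) has_vector_derivative d) (at (snd p) within slice2 U p)"
  shows "partial2 U f p = d"
  using assms unfolding partial2_def slicewise_perfect_def by (blast intro: vector_derivative_within)

text \<open>The slice through \<open>p\<close> lies in \<open>U\<close>, so agreement on
  \<open>U\<close> suffices even at boundary points. An inner partial, known only on
  \<open>U\<close>, can thus be replaced by its closed form before the outer one is taken.\<close>

lemma partial1_cong:
  assumes "p \<in> U" "\<And>q. q \<in> U \<Longrightarrow> f q = g q"
  shows "partial1 U f p = partial1 U g p"
  unfolding partial1_def using assms
  by (intro vector_derivative_cong_eq always_eventually) (auto simp: slice1_def)

lemma partial2_cong:
  assumes "p \<in> U" "\<And>q. q \<in> U \<Longrightarrow> f q = g q"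
  shows "partial2 U f p = partial2 U g p"
  unfolding partial2_def using assms
  by (intro vector_derivative_cong_eq always_eventually) (auto simp: slice2_def)

lemma C1_on_iff_has_C1_partials:
  "C1_on U f \<longleftrightarrow> has_C1_partials U f (partial1 U f) (partial2 U f)"
  unfolding C1_on_def has_C1_partials_def partial1_def partial2_def vector_derivative_works
  by auto

lemma has_C1_partials_cong:
  assumes "\<And>p. p \<in> U \<Longrightarrow> f p = g p" "\<And>p. p \<in> U \<Longrightarrow> f1 p = g1 p" "\<And>p. p \<in> U \<Longrightarrow> f2 p = g2 p"
  shows "has_C1_partials U f f1 f2 \<longleftrightarrow> has_C1_partials U g g1 g2"
proof -
  \<comment> \<open>The hypotheses are symmetric; one implication for arbitrary functions serves
    both directions.\<close>
  have *: "has_C1_partials U g g1 g2"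
    if f: "has_C1_partials U f f1 f2"
      and e: "\<And>p. p \<in> U \<Longrightarrow> f p = g p" "\<And>p. p \<in> U \<Longrightarrow> f1 p = g1 p" "\<And>p. p \<in> U \<Longrightarrow> f2 p = g2 p"
    for f f1 f2 g g1 g2 :: "point \<Rightarrow> 'a"
    unfolding has_C1_partials_def
  proof (intro conjI ballI)
    show "continuous_on U g" "continuous_on U g1" "continuous_on U g2"
      using f e continuous_on_cong[OF refl, of U] unfolding has_C1_partials_def by metis+
  next
    fix p assume p: "p \<in> U"
    have "((\<lambda>t. f (t, snd p)) has_vector_derivative g1 p) (at (fst p) within slice1 U p)"
      using f e(2,3) p unfolding has_C1_partials_def by simp
    then show "((\<lambda>t. g (t, snd p)) has_vector_derivative g1 p) (at (fst p) within slice1 U p)"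
      by (rule has_vector_derivative_transform[rotated 2]) (use p e in \<open>auto simp: slice1_def\<close>)
    have "((\<lambda>t. f (fst p, t)) has_vector_derivative g2 p) (at (snd p) within slice2 U p)"
      using f e(2,3) p unfolding has_C1_partials_def by simp
    then show "((\<lambda>t. g (fst p, t)) has_vector_derivative g2 p) (at (snd p) within slice2 U p)"
      by (rule has_vector_derivative_transform[rotated 2]) (use p e in \<open>auto simp: slice2_def\<close>)
  qed
  show ?thesis by (rule iffI; erule *) (simp_all add: assms)
qed

lemma has_C1_partials_eq:
  assumes "slicewise_perfect U" "has_C1_partials U f f1 f2" "p \<in> U"
  shows "partial1 U f p = f1 p" "partial2 U f p = f2 p"
  using assms by (auto simp: has_C1_partials_def intro!: partial1_eq partial2_eq)

lemma has_C1_partials_imp_C1_on: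
  assumes "slicewise_perfect U" "has_C1_partials U f f1 f2"
  shows "C1_on U f"
  unfolding C1_on_iff_has_C1_partials using assms(2)
  by (rule has_C1_partials_cong[THEN iffD1, rotated -1]) (simp_all add: has_C1_partials_eq[OF assms])

lemma C1_on_cong:
  assumes "\<And>p. p \<in> U \<Longrightarrow> f p = g p"
  shows "C1_on U f \<longleftrightarrow> C1_on U g"
  unfolding C1_on_iff_has_C1_partials
  by (intro has_C1_partials_cong partial1_cong partial2_cong assms)

lemma C2_onI:
  assumes U: "slicewise_perfect U" and f: "has_C1_partials U f f1 f2"
    and f1: "has_C1_partials U f1 f11 f12" and f2: "has_C1_partials U f2 f21 f22"
  shows "C2_on U f"
  unfolding C2_on_def
  using has_C1_partials_imp_C1_on[OF U f] has_C1_partials_imp_C1_on[OF U f1]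
    has_C1_partials_imp_C1_on[OF U f2] has_C1_partials_eq[OF U f]
    C1_on_cong[of U "partial1 U f" f1] C1_on_cong[of U "partial2 U f" f2] by blast

lemma second_partials_eq:
  assumes U: "slicewise_perfect U" and f: "has_C1_partials U f f1 f2" and p: "p \<in> U"
  shows "has_C1_partials U f1 f11 f12 \<Longrightarrow> partial1 U (partial1 U f) p = f11 p"
    and "has_C1_partials U f2 f21 f22 \<Longrightarrow> partial2 U (partial2 U f) p = f22 p"
proof -
  show "partial1 U (partial1 U f) p = f11 p" if "has_C1_partials U f1 f11 f12"
    using partial1_cong[OF p has_C1_partials_eq(1)[OF U f]] has_C1_partials_eq(1)[OF U that p] by simp
  show "partial2 U (partial2 U f) p = f22 p" if "has_C1_partials U f2 f21 f22"
    using partial2_cong[OF p has_C1_partials_eq(2)[OF U f]] has_C1_partials_eq(2)[OF U that p] by simp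
qed

section \<open>Product, scaling and exponential rules for partial derivatives\<close>

lemma has_C1_partials_of_real:
  fixes F :: "point \<Rightarrow> real"
  assumes "has_C1_partials U F F1 F2"
  shows "has_C1_partials U (\<lambda>p. of_real (F p) :: complex) (\<lambda>p. of_real (F1 p)) (\<lambda>p. of_real (F2 p))"
  by (intro has_C1_partialsI continuous_on_of_real has_vector_derivative_of_real)
     (simp_all add: has_C1_partialsD[OF assms] has_real_derivative_iff_has_vector_derivative)

lemma has_C1_partials_mult:
  fixes f g :: "point \<Rightarrow> complex"
  assumes "has_C1_partials U f f1 f2" "has_C1_partials U g g1 g2"
  shows "has_C1_partials U (\<lambda>p. f p * g p) (\<lambda>p. f p * g1 p + f1 p * g p) (\<lambda>p. f p * g2 p + f2 p * g p)"
  by (intro has_C1_partialsI continuous_on_mult continuous_on_add has_vector_derivative_mult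
      has_C1_partialsD[OF assms(1)] has_C1_partialsD[OF assms(2)])

lemma has_C1_partials_const: "has_C1_partials U (\<lambda>p. c) (\<lambda>p. 0) (\<lambda>p. 0)"
  unfolding has_C1_partials_def by simp

lemma has_C1_partials_cmult:
  fixes f :: "point \<Rightarrow> complex"
  assumes "has_C1_partials U f f1 f2"
  shows "has_C1_partials U (\<lambda>p. c * f p) (\<lambda>p. c * f1 p) (\<lambda>p. c * f2 p)"
  using has_C1_partials_mult[OF has_C1_partials_const assms] by simp

lemma has_vector_derivative_exp:
  fixes f :: "real \<Rightarrow> complex"
  assumes "(f has_vector_derivative f') (at x within S)"
  shows "((\<lambda>t. exp (f t)) has_vector_derivative f' * exp (f x)) (at x within S)"
  using field_vector_diff_chain_within[OF assms, of exp "exp (f x)"]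
  by (simp add: o_def DERIV_exp has_field_derivative_at_within)

lemma has_C1_partials_exp:
  fixes f :: "point \<Rightarrow> complex"
  assumes "has_C1_partials U f f1 f2"
  shows "has_C1_partials U (\<lambda>p. exp (f p)) (\<lambda>p. f1 p * exp (f p)) (\<lambda>p. f2 p * exp (f p))"
  by (intro has_C1_partialsI continuous_on_mult continuous_on_exp has_vector_derivative_exp
      has_C1_partialsD[OF assms])

section \<open>The slices of the two coordinate domains\<close>

lemma slice_half_plane:
  assumes "p \<in> half_plane"
  shows "slice1 half_plane p = UNIV" "slice2 half_plane p = {0<..}"
  using assms by (auto simp: half_plane_def slice1_def slice2_def)

lemma slicewise_perfect_half_plane: "slicewise_perfect half_plane"
  unfolding slicewise_perfect_def
proof
  fix p assume p: "p \<in> half_plane"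
  then have "at (snd p) within {0<..} = at (snd p)"
    by (intro at_within_open) (auto simp: half_plane_def)
  then show "at (fst p) within slice1 half_plane p \<noteq> bot \<and> at (snd p) within slice2 half_plane p \<noteq> bot"
    using p by (simp add: slice_half_plane)
qed

lemma slice_beltrami_domain:
  assumes "p \<in> beltrami_domain"
  shows "slice1 beltrami_domain p = {0..}" "slice2 beltrami_domain p = UNIV"
  using assms by (auto simp: beltrami_domain_def slice1_def slice2_def)

text \<open>At \<open>u = 0\<close> only the right-hand side is left in the filter; comparison with
  \<open>at_right\<close> treats this point like all others.\<close>

lemma at_within_atLeast_neq_bot: "u \<ge> 0 \<Longrightarrow> at u within {0..} \<noteq> bot" for u :: real
proof -
  assume "u \<ge> 0"
  then have "at_right u \<le> at u within {0..}" by (intro at_le) auto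
  then show ?thesis using trivial_limit_at_right_real bot_unique by metis
qed

lemma slicewise_perfect_beltrami_domain: "slicewise_perfect beltrami_domain"
  unfolding slicewise_perfect_def
  by (auto simp: slice_beltrami_domain at_within_atLeast_neq_bot) 
     (auto simp: beltrami_domain_def at_within_atLeast_neq_bot)

subsection \<open>Laplace--Beltrami operators\<close>

text \<open>\<open>W\<close> is the area density, \<open>\<alpha>\<close> is \<open>G / W\<close>
  and \<open>\<beta>\<close> is \<open>E / W\<close>. Supplying them as data removes the square root
  before anything is differentiated.\<close>

lemma laplace_beltrami_diagonal:
  assumes p: "p \<in> U" and W: "\<And>q. q \<in> U \<Longrightarrow> W q > 0"
    and EG: "\<And>q. q \<in> U \<Longrightarrow> E q = \<beta> q * W q \<and> G q = \<alpha> q * W q"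
    and \<alpha>\<beta>: "\<And>q. q \<in> U \<Longrightarrow> \<alpha> q * \<beta> q = 1"
  shows "laplace_beltrami U (E, (\<lambda>p. 0), G) f p =
    (partial1 U (\<lambda>q. \<alpha> q *\<^sub>R partial1 U f q) p + partial2 U (\<lambda>q. \<beta> q *\<^sub>R partial2 U f q) p) /\<^sub>R W p"
proof -
  have EG': "E q * G q = (W q)\<^sup>2" if "q \<in> U" for q
  proof -
    have "E q * G q = (\<alpha> q * \<beta> q) * (W q)\<^sup>2"
      using EG[OF that] by (simp add: power2_eq_square mult_ac)
    then show ?thesis using \<alpha>\<beta>[OF that] by simp
  qed
  have root: "sqrt (E q * G q - 0\<^sup>2) = W q" if "q \<in> U" for q
    using EG'[OF that] W[OF that] by simp
  have "partial1 U (\<lambda>q. (G q *\<^sub>R partial1 U f q - 0 *\<^sub>R partial2 U f q) /\<^sub>R sqrt (E q * G q - 0\<^sup>2)) p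
      = partial1 U (\<lambda>q. \<alpha> q *\<^sub>R partial1 U f q) p"
    by (rule partial1_cong[OF p], subst root) (use W EG in \<open>force+\<close>)
  moreover have "partial2 U (\<lambda>q. (E q *\<^sub>R partial2 U f q - 0 *\<^sub>R partial1 U f q) /\<^sub>R sqrt (E q * G q - 0\<^sup>2)) p
      = partial2 U (\<lambda>q. \<beta> q *\<^sub>R partial2 U f q) p"
    by (rule partial2_cong[OF p], subst root) (use W EG in \<open>force+\<close>)
  ultimately show ?thesis
    unfolding laplace_beltrami_def split Let_def root[OF p] by (simp only:)
qed

text \<open>In dimension two a conformal factor cancels from both weights, which are 1 here, and
  survives only in the outer factor \<open>1 / W\<close>.\<close>

lemma laplace_beltrami_hyperbolic:
  assumes p: "p \<in> half_plane"
  shows "laplace_beltrami half_plane hyperbolic_metric f p = hyperbolic_laplacian f p"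
proof -
  have "laplace_beltrami half_plane hyperbolic_metric f p =
      (partial1 half_plane (\<lambda>q. 1 *\<^sub>R partial1 half_plane f q) p
        + partial2 half_plane (\<lambda>q. 1 *\<^sub>R partial2 half_plane f q) p) /\<^sub>R (1 / snd p)\<^sup>2"
    unfolding hyperbolic_metric_def optical_metric_def case_prod_unfold
    by (rule laplace_beltrami_diagonal[OF p]) (auto simp: half_plane_def)
  then show ?thesis
    by (simp add: hyperbolic_laplacian_def power_one_over)
qed

subsection \<open>Horocyclic waves\<close>

text \<open>One formula for both kinds of normal, with \<open>e = 0\<close> at infinity and
  \<open>e = 1\<close> at a finite point, so that the partials are computed only once.\<close>

lemma horo_coordinate_eq:
  assumes "h > 0"
  obtains e c :: real where "e = 0 \<or> e = 1"
    "\<And>p. p \<in> half_plane \<Longrightarrow>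
       horo_coordinate b h p = ln (snd p) - e * ln ((fst p - c)\<^sup>2 + (snd p)\<^sup>2) - ln h"
proof (cases b)
  case None
  show thesis
    \<comment> \<open>\<open>e = 0\<close> switches off the second logarithm, and the value 0 of
      \<open>c\<close> is a placeholder.\<close>
    by (rule that[of 0 0])
       (use assms None in \<open>auto simp: horo_coordinate_def horo_height_def half_plane_def ln_div\<close>)
next
  case (Some c)
  have "horo_coordinate b h p = ln (snd p) - 1 * ln ((fst p - c)\<^sup>2 + (snd p)\<^sup>2) - ln h"
    if "p \<in> half_plane" for p
  proof -
    have "snd p > 0" using that by (auto simp: half_plane_def)
    moreover define r where "r = (fst p - c)\<^sup>2 + (snd p)\<^sup>2"
    ultimately have "snd p > 0" "r > 0" by (simp_all add: add_nonneg_pos)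
    then show ?thesis
      using assms Some
      by (simp add: horo_coordinate_def horo_height_def case_prod_unfold ln_div ln_mult flip: r_def)
  qed
  then show thesis using that[of 1 c] by blast
qed

text \<open>The last two conclusions are the eikonal equation and \<open>\<Delta> F = -1\<close>; the latter is the
  statement that horocycles have geodesic curvature 1.\<close>

lemma horo_coordinate_partials:
  assumes "h > 0"
  obtains F1 F2 F11 F12 F22 where
    "has_C1_partials half_plane (horo_coordinate b h) F1 F2"
    "has_C1_partials half_plane F1 F11 F12" "has_C1_partials half_plane F2 F12 F22"
    "\<And>p. p \<in> half_plane \<Longrightarrow> (snd p)\<^sup>2 * ((F1 p)\<^sup>2 + (F2 p)\<^sup>2) = 1"
    "\<And>p. p \<in> half_plane \<Longrightarrow> (snd p)\<^sup>2 * (F11 p + F22 p) = - 1"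
proof -
  obtain e c where e: "e = 0 \<or> e = 1"
    and eq: "\<And>p. p \<in> half_plane \<Longrightarrow>
       horo_coordinate b h p = ln (snd p) - e * ln ((fst p - c)\<^sup>2 + (snd p)\<^sup>2) - ln h"
    using horo_coordinate_eq[OF assms] by metis
  define X where "X = (\<lambda>p::point. fst p - c)"
  define R where "R = (\<lambda>p::point. (fst p - c)\<^sup>2 + (snd p)\<^sup>2)"
  define F1 where "F1 = (\<lambda>p. - 2 * e * X p / R p)"
  define F2 where "F2 = (\<lambda>p. 1 / snd p - 2 * e * snd p / R p)"
  define F11 where "F11 = (\<lambda>p. - 2 * e / R p + 4 * e * (X p)\<^sup>2 / (R p)\<^sup>2)"
  define F12 where "F12 = (\<lambda>p. 4 * e * X p * snd p / (R p)\<^sup>2)"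
  define F22 where "F22 = (\<lambda>p. - 1 / (snd p)\<^sup>2 - 2 * e / R p + 4 * e * (snd p)\<^sup>2 / (R p)\<^sup>2)"
  note defs = X_def R_def F1_def F2_def F11_def F12_def F22_def
  have y: "snd p > 0" if "p \<in> half_plane" for p using that by (auto simp: half_plane_def)
  have r: "R p > 0" if "p \<in> half_plane" for p
    using y[OF that] by (simp add: R_def add_nonneg_pos)
  have nz: "y \<noteq> 0" "(x - c)\<^sup>2 + y\<^sup>2 \<noteq> 0" "y > 0" "(x - c)\<^sup>2 + y\<^sup>2 > 0" if "(x, y) \<in> half_plane" for x y
    using y[OF that] r[OF that] by (auto simp: R_def)
  have cont: "continuous_on half_plane X" "continuous_on half_plane R" "continuous_on half_plane snd"
    unfolding X_def R_def by (intro continuous_intros)+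
  have contF: "continuous_on half_plane F1" "continuous_on half_plane F2" "continuous_on half_plane F11"
      "continuous_on half_plane F12" "continuous_on half_plane F22"
    unfolding F1_def F2_def F11_def F12_def F22_def
    using y r by (intro continuous_intros cont; force)+
  have cont0: "continuous_on half_plane (\<lambda>p. ln (snd p) - e * ln (R p) - ln h)"
    using y r by (intro continuous_intros cont; force)+
  show thesis
  proof (rule that)
    have "has_C1_partials half_plane (\<lambda>p. ln (snd p) - e * ln (R p) - ln h) F1 F2"
      by (intro has_C1_partialsI cont0 contF)
         (use nz in \<open>auto simp: defs has_real_derivative_iff_has_vector_derivative[symmetric]
            intro!: derivative_eq_intros simp: divide_simps\<close>)
    then show "has_C1_partials half_plane (horo_coordinate b h) F1 F2"
      by (rule has_C1_partials_cong[THEN iffD1, rotated -1]) (simp_all add: eq R_def)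
    show "has_C1_partials half_plane F1 F11 F12"
      by (intro has_C1_partialsI contF)
         (use nz in \<open>auto simp: defs has_real_derivative_iff_has_vector_derivative[symmetric]
            intro!: derivative_eq_intros simp: divide_simps power2_eq_square\<close>)
    have "((\<lambda>t. 1 / y - 2 * e * y / ((t - c)\<^sup>2 + y\<^sup>2)) has_real_derivative
             4 * e * (x - c) * y / ((x - c)\<^sup>2 + y\<^sup>2)\<^sup>2) (at x within S)"
         "((\<lambda>t. 1 / t - 2 * e * t / ((x - c)\<^sup>2 + t\<^sup>2)) has_real_derivative
             - 1 / y\<^sup>2 - 2 * e / ((x - c)\<^sup>2 + y\<^sup>2) + 4 * e * y\<^sup>2 / ((x - c)\<^sup>2 + y\<^sup>2)\<^sup>2) (at y within S)"
      if xy: "(x, y) \<in> half_plane" for x y S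
    proof -
      \<comment> \<open>The quadratic denominator is abstracted to a function \<open>g\<close>,
        nonzero at the point, so that its square is not expanded during differentiation.\<close>
      have D1: "((\<lambda>t. 1 / y - 2 * e * y / g t) has_real_derivative 2 * e * y * g' / (g x)\<^sup>2) (at x within S)"
        if "(g has_real_derivative g') (at x within S)" "g x \<noteq> 0" for g g'
        using that by (auto intro!: derivative_eq_intros simp: power2_eq_square)
      have D2: "((\<lambda>t. 1 / t - 2 * e * t / g t) has_real_derivative
          - 1 / y\<^sup>2 - 2 * e / g y + 2 * e * y * g' / (g y)\<^sup>2) (at y within S)"
        if "(g has_real_derivative g') (at y within S)" "g y \<noteq> 0" for g g'
        using that nz[OF xy]
        by (auto intro!: derivative_eq_intros simp: power2_eq_square diff_divide_distrib)
      have "((\<lambda>t. (t - c)\<^sup>2 + y\<^sup>2) has_real_derivative 2 * (x - c)) (at x within S)"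
        by (auto intro!: derivative_eq_intros)
      from D1[OF this nz(2)[OF xy]]
      show "((\<lambda>t. 1 / y - 2 * e * y / ((t - c)\<^sup>2 + y\<^sup>2)) has_real_derivative
             4 * e * (x - c) * y / ((x - c)\<^sup>2 + y\<^sup>2)\<^sup>2) (at x within S)"
        by (simp add: mult_ac)
      have "((\<lambda>t. (x - c)\<^sup>2 + t\<^sup>2) has_real_derivative 2 * y) (at y within S)"
        by (auto intro!: derivative_eq_intros)
      from D2[OF this nz(2)[OF xy]]
      show "((\<lambda>t. 1 / t - 2 * e * t / ((x - c)\<^sup>2 + t\<^sup>2)) has_real_derivative
             - 1 / y\<^sup>2 - 2 * e / ((x - c)\<^sup>2 + y\<^sup>2) + 4 * e * y\<^sup>2 / ((x - c)\<^sup>2 + y\<^sup>2)\<^sup>2) (at y within S)"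
        by (simp add: power2_eq_square[of y] mult_ac)
    qed
    then show "has_C1_partials half_plane F2 F12 F22"
      by (intro has_C1_partialsI contF)
         (simp_all add: defs flip: has_real_derivative_iff_has_vector_derivative)
  next
    fix p assume p: "p \<in> half_plane"
    have R: "R p = (X p)\<^sup>2 + (snd p)\<^sup>2" by (simp add: X_def R_def)
    show "(snd p)\<^sup>2 * ((F1 p)\<^sup>2 + (F2 p)\<^sup>2) = 1"
      using e y[OF p] r[OF p] unfolding F1_def F2_def
      by (auto simp: field_simps) (simp add: R power2_eq_square power4_eq_xxxx algebra_simps)
    \<comment> \<open>\<open>ln R\<close> is harmonic, so only \<open>ln (snd p)\<close>
      contributes.\<close>
    show "(snd p)\<^sup>2 * (F11 p + F22 p) = - 1"
      using e y[OF p] r[OF p] unfolding F11_def F22_def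
      by (auto simp: field_simps) (simp add: R power2_eq_square power4_eq_xxxx algebra_simps)
  qed
qed

text \<open>The chain rule turns the Laplacian into multiplication by \<open>s\<^sup>2\<close> times
  the squared gradient of \<open>F\<close> plus \<open>s\<close> times its Laplacian. The constant
  \<open>k\<close> makes room for the factor C depending on the spectral parameter.\<close>

lemma exp_wave:
  fixes k s :: complex
  assumes F: "has_C1_partials half_plane F F1 F2"
    and F1: "has_C1_partials half_plane F1 F11 F12" and F2: "has_C1_partials half_plane F2 F12 F22"
    and eik: "\<And>p. p \<in> half_plane \<Longrightarrow> (snd p)\<^sup>2 * ((F1 p)\<^sup>2 + (F2 p)\<^sup>2) = 1"
    and lap: "\<And>p. p \<in> half_plane \<Longrightarrow> (snd p)\<^sup>2 * (F11 p + F22 p) = - 1"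
  defines "\<psi> \<equiv> \<lambda>p. k * exp (s * of_real (F p))"
  shows "C2_on half_plane \<psi>"
    and "p \<in> half_plane \<Longrightarrow> hyperbolic_laplacian \<psi> p = s * (s - 1) * \<psi> p"
proof -
  note C1 = has_C1_partials_of_real has_C1_partials_cmult has_C1_partials_mult has_C1_partials_exp
  \<comment> \<open>Each first partial is written as a multiple of \<open>\<psi>\<close> itself, so
    the second differentiation is the product rule applied to this same fact.\<close>
  have 0: "has_C1_partials half_plane \<psi> (\<lambda>p. s * of_real (F1 p) * \<psi> p) (\<lambda>p. s * of_real (F2 p) * \<psi> p)"
    unfolding \<psi>_def using C1(2)[OF C1(4)[OF C1(2)[OF C1(1)[OF F]]], of k s] by (simp add: mult_ac)
  note d1 = C1(3)[OF C1(2)[OF C1(1)[OF F1]] 0, of s]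
  note d2 = C1(3)[OF C1(2)[OF C1(1)[OF F2]] 0, of s]
  show "C2_on half_plane \<psi>"
    by (rule C2_onI[OF slicewise_perfect_half_plane 0 d1 d2])
  assume p: "p \<in> half_plane"
  have "hyperbolic_laplacian \<psi> p
      = (s\<^sup>2 * of_real ((snd p)\<^sup>2 * ((F1 p)\<^sup>2 + (F2 p)\<^sup>2)) + s * of_real ((snd p)\<^sup>2 * (F11 p + F22 p))) * \<psi> p"
    unfolding hyperbolic_laplacian_def
      second_partials_eq(1)[OF slicewise_perfect_half_plane 0 p d1]
      second_partials_eq(2)[OF slicewise_perfect_half_plane 0 p d2]
    by (simp add: scaleR_conv_of_real power2_eq_square algebra_simps)
  then show "hyperbolic_laplacian \<psi> p = s * (s - 1) * \<psi> p"
    unfolding eik[OF p] lap[OF p] by (simp add: power2_eq_square algebra_simps)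
qed

lemma horocyclic_wave:
  assumes "h > 0"
  shows "C2_on half_plane (\<lambda>p. k * horocyclic_wave b h lam p)"
    and "p \<in> half_plane \<Longrightarrow> laplace_beltrami half_plane hyperbolic_metric (\<lambda>p. k * horocyclic_wave b h lam p) p
      = - of_real (lam\<^sup>2 + 1/4) * (k * horocyclic_wave b h lam p)"
proof -
  obtain F1 F2 F11 F12 F22 where F: "has_C1_partials half_plane (horo_coordinate b h) F1 F2"
    "has_C1_partials half_plane F1 F11 F12" "has_C1_partials half_plane F2 F12 F22"
    "\<And>p. p \<in> half_plane \<Longrightarrow> (snd p)\<^sup>2 * ((F1 p)\<^sup>2 + (F2 p)\<^sup>2) = 1"
    "\<And>p. p \<in> half_plane \<Longrightarrow> (snd p)\<^sup>2 * (F11 p + F22 p) = - 1"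
    using horo_coordinate_partials[OF assms] by metis
  show "C2_on half_plane (\<lambda>p. k * horocyclic_wave b h lam p)"
    unfolding horocyclic_wave_def by (rule exp_wave(1)[OF F])
  have s: "(1/2 - \<i> * of_real lam) * (1/2 - \<i> * of_real lam - 1) = - of_real (lam\<^sup>2 + 1/4)"
    by (simp add: complex_eq_iff power2_eq_square algebra_simps)
  show "laplace_beltrami half_plane hyperbolic_metric (\<lambda>p. k * horocyclic_wave b h lam p) p
      = - of_real (lam\<^sup>2 + 1/4) * (k * horocyclic_wave b h lam p)" if "p \<in> half_plane"
    unfolding laplace_beltrami_hyperbolic[OF that] horocyclic_wave_def
    by (rule trans[OF exp_wave(2)[OF F that] arg_cong2[OF s refl, of "(*)"]])
qed

lemma wave_function_horocyclic_wave:
  assumes "h > 0"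
  shows "wave_function lam (\<lambda>p. k * horocyclic_wave b h lam p)"
  unfolding wave_function_def helmholtz_def
  by (intro conjI ballI horocyclic_wave(1)[OF assms])
     (simp only: horocyclic_wave(2)[OF assms] mult_minus_left left_minus)

text \<open>The wave has no zeros, so its eigenvalue is determined. The value
  \<open>lam\<^sup>2 + 1/4\<close> is therefore forced by the waves and is not just a convention in
  \<open>wave_function\<close>.\<close>

lemma helmholtz_horocyclic_wave_iff:
  assumes "h > 0"
  shows "helmholtz half_plane hyperbolic_metric k2 (horocyclic_wave b h lam) \<longleftrightarrow> k2 = lam\<^sup>2 + 1/4"
proof -
  have *: "laplace_beltrami half_plane hyperbolic_metric (horocyclic_wave b h lam) p
      + of_real k2 * horocyclic_wave b h lam p
    = of_real (k2 - (lam\<^sup>2 + 1/4)) * horocyclic_wave b h lam p" if "p \<in> half_plane" for p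
    using horocyclic_wave(2)[OF assms that, of 1 b lam]
    by (simp only: mult_1_left of_real_diff left_diff_distrib mult_minus_left) simp
  have "horocyclic_wave b h lam p \<noteq> 0" for p by (simp add: horocyclic_wave_def)
  then have "helmholtz half_plane hyperbolic_metric k2 (horocyclic_wave b h lam) \<longleftrightarrow>
      (\<forall>p\<in>half_plane. k2 - (lam\<^sup>2 + 1/4) = 0)"
    by (simp only: helmholtz_def * mult_eq_0_iff of_real_eq_0_iff simp_thms cong: ball_cong)
  moreover have "(0, 1) \<in> half_plane" by (simp add: half_plane_def)
  ultimately show ?thesis by auto
qed

lemma wave_function_iff:
  "wave_function lam \<psi> \<longleftrightarrow> C2_on half_plane \<psi> \<and>
     (\<forall>p\<in>half_plane. hyperbolic_laplacian \<psi> p + of_real (lam\<^sup>2 + 1/4) * \<psi> p = 0)"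
  by (simp add: wave_function_def helmholtz_def laplace_beltrami_hyperbolic)

subsection \<open>Functions of the first Beltrami coordinate\<close>

definition has_derivatives2 ::
    "(real \<Rightarrow> 'a::real_normed_vector) \<Rightarrow> (real \<Rightarrow> 'a) \<Rightarrow> (real \<Rightarrow> 'a) \<Rightarrow> bool" where
  "has_derivatives2 g g' g'' \<longleftrightarrow>
     (\<forall>u\<ge>0. (g has_vector_derivative g' u) (at u within {0..}) \<and>
            (g' has_vector_derivative g'' u) (at u within {0..}))"

lemma beltrami_partials_fst:
  assumes "p \<in> beltrami_domain" "(g has_vector_derivative g') (at (fst p) within {0..})"
  shows "partial1 beltrami_domain (\<lambda>q. g (fst q)) p = g'"
    "partial2 beltrami_domain (\<lambda>q. g (fst q)) p = 0"
  using assms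
  by (auto intro!: partial1_eq[OF slicewise_perfect_beltrami_domain]
      partial2_eq[OF slicewise_perfect_beltrami_domain] simp: slice_beltrami_domain)

lemma C2_on_fst_imp_has_derivatives2:
  assumes "C2_on beltrami_domain (\<lambda>p. g (fst p))"
  obtains g' g'' where "has_derivatives2 g g' g''"
proof -
  \<comment> \<open>The function depends on u alone, so its partials may be read off on the line v =
    0.\<close>
  define g' where "g' = (\<lambda>u. partial1 beltrami_domain (\<lambda>p. g (fst p)) (u, 0))"
  define g'' where "g'' = (\<lambda>u. partial1 beltrami_domain (partial1 beltrami_domain (\<lambda>p. g (fst p))) (u, 0))"
  have "has_derivatives2 g g' g''"
    unfolding has_derivatives2_def
  proof (intro allI impI)
    fix u :: real assume "u \<ge> 0"
    then have p: "(u, 0) \<in> beltrami_domain" by (simp add: beltrami_domain_def)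
    then show "(g has_vector_derivative g' u) (at u within {0..}) \<and>
        (g' has_vector_derivative g'' u) (at u within {0..})"
      using assms has_C1_partialsD(4)[OF _ p]
      unfolding C2_on_def C1_on_iff_has_C1_partials g'_def g''_def slice_beltrami_domain[OF p]
      by fastforce
  qed
  then show thesis by (rule that)
qed

lemma has_derivatives2_imp_C2_on_fst:
  assumes g: "has_derivatives2 g g' g''" and cont: "continuous_on {0..} g''"
  shows "C2_on beltrami_domain (\<lambda>p. g (fst p))"
proof -
  have co: "continuous_on beltrami_domain (\<lambda>p. f (fst p))" if "continuous_on {0..} f" for f :: "real \<Rightarrow> 'a"
    by (rule continuous_on_compose2[OF that]) (auto intro!: continuous_intros simp: beltrami_domain_def)
  have "continuous_on {0..} g" "continuous_on {0..} g'"
    using g unfolding has_derivatives2_def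
    by (auto intro!: continuous_on_vector_derivative)
  note co = this[THEN co] cont[THEN co]
  have "has_C1_partials beltrami_domain (\<lambda>p. g (fst p)) (\<lambda>p. g' (fst p)) (\<lambda>p. 0)"
      "has_C1_partials beltrami_domain (\<lambda>p. g' (fst p)) (\<lambda>p. g'' (fst p)) (\<lambda>p. 0)"
    using g by (auto intro!: has_C1_partialsI co simp: slice_beltrami_domain has_derivatives2_def)
       (auto simp: beltrami_domain_def)
  then show ?thesis
    using C2_onI[OF slicewise_perfect_beltrami_domain _ _ has_C1_partials_const] by blast
qed

text \<open>The area density is exp(-u), so on functions of u the operator is exp(u) d/du (exp(-u)
  d/du); differentiating the weight produces the first-order term.\<close>

lemma laplace_beltrami_beltrami_fst:
  assumes g: "has_derivatives2 g g' g''" and p: "p \<in> beltrami_domain"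
  shows "laplace_beltrami beltrami_domain beltrami_metric (\<lambda>q. g (fst q)) p = g'' (fst p) - g' (fst p)"
proof -
  let ?U = beltrami_domain
  have u: "fst q \<ge> 0" if "q \<in> ?U" for q using that by (auto simp: beltrami_domain_def)
  have dg: "(g has_vector_derivative g' (fst q)) (at (fst q) within {0..})" if "q \<in> ?U" for q
    using g u[OF that] by (simp add: has_derivatives2_def)
  have "((\<lambda>t. exp (- t) *\<^sub>R g' t) has_vector_derivative exp (- fst p) *\<^sub>R g'' (fst p) + (- exp (- fst p)) *\<^sub>R g' (fst p))
      (at (fst p) within {0..})"
    using g u[OF p] unfolding has_derivatives2_def
    by (intro has_vector_derivative_scaleR) (auto intro!: derivative_eq_intros)
  note d = beltrami_partials_fst(1)[OF p this]
  have "partial1 ?U (\<lambda>q. exp (- fst q) *\<^sub>R partial1 ?U (\<lambda>q. g (fst q)) q) p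
      = partial1 ?U (\<lambda>q. exp (- fst q) *\<^sub>R g' (fst q)) p"
    by (intro partial1_cong[OF p]) (simp add: beltrami_partials_fst(1)[OF _ dg])
  moreover have "partial2 ?U (\<lambda>q. exp (fst q) *\<^sub>R partial2 ?U (\<lambda>q. g (fst q)) q) p = partial2 ?U (\<lambda>q. 0) p"
    by (intro partial2_cong[OF p]) (simp add: beltrami_partials_fst(2)[OF _ dg])
  moreover have "partial2 ?U (\<lambda>q. 0 :: complex) p = 0"
    by (intro partial2_eq[OF slicewise_perfect_beltrami_domain p]) simp
  moreover have "laplace_beltrami ?U beltrami_metric (\<lambda>q. g (fst q)) p =
      (partial1 ?U (\<lambda>q. exp (- fst q) *\<^sub>R partial1 ?U (\<lambda>q. g (fst q)) q) p
        + partial2 ?U (\<lambda>q. exp (fst q) *\<^sub>R partial2 ?U (\<lambda>q. g (fst q)) q) p) /\<^sub>R exp (- fst p)"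
    unfolding beltrami_metric_def case_prod_unfold
    by (rule laplace_beltrami_diagonal[OF p]) (auto simp flip: exp_add)
  ultimately show ?thesis
    using d by (simp flip: scaleR_diff_right)
qed

section \<open>Substitution of the geometrical term in the Helmholtz equation\<close>

lemma has_derivatives2_geometrical_term:
  assumes \<Phi>: "has_derivatives2 \<Phi> \<Phi>' \<Phi>''" and A: "has_derivatives2 A A' A''"
  defines "s \<equiv> \<lambda>lam. 1/2 - \<i> * of_real lam"
  defines "E \<equiv> \<lambda>lam u. exp (s lam * of_real (\<Phi> u))"
  shows "has_derivatives2 (geometrical_term \<Phi> A lam)
    (\<lambda>u. (A' u + s lam * A u * \<Phi>' u) * E lam u)
    (\<lambda>u. (A'' u + s lam * (2 * A' u * \<Phi>' u + A u * \<Phi>'' u) + (s lam)\<^sup>2 * A u * (\<Phi>' u)\<^sup>2) * E lam u)"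
  unfolding has_derivatives2_def
proof (intro allI impI)
  fix u :: real assume u: "u \<ge> 0"
  let ?s = "s lam" and ?N = "at u within {0..}"
  have \<Phi>1: "((\<lambda>t. complex_of_real (\<Phi> t)) has_vector_derivative \<Phi>' u) ?N"
    and \<Phi>2: "((\<lambda>t. complex_of_real (\<Phi>' t)) has_vector_derivative \<Phi>'' u) ?N"
    using \<Phi> u unfolding has_derivatives2_def
    by (auto intro!: has_vector_derivative_of_real simp: has_real_derivative_iff_has_vector_derivative)
  have A1: "(A has_vector_derivative A' u) ?N" and A2: "(A' has_vector_derivative A'' u) ?N"
    using A u by (auto simp: has_derivatives2_def)
  have E: "(E lam has_vector_derivative ?s * \<Phi>' u * E lam u) ?N"
    using has_vector_derivative_exp[OF has_vector_derivative_mult_right[OF \<Phi>1, of ?s]] by (simp add: E_def)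
  have "((\<lambda>u. A u * E lam u) has_vector_derivative (A' u + ?s * A u * \<Phi>' u) * E lam u) ?N"
    using has_vector_derivative_mult[OF A1 E] by (simp add: algebra_simps)
  moreover have "geometrical_term \<Phi> A lam = (\<lambda>u. A u * E lam u)"
    by (simp add: fun_eq_iff geometrical_term_def E_def s_def)
  moreover have "((\<lambda>u. (A' u + ?s * A u * \<Phi>' u) * E lam u) has_vector_derivative
      (A'' u + ?s * (2 * A' u * \<Phi>' u + A u * \<Phi>'' u) + ?s\<^sup>2 * A u * (\<Phi>' u)\<^sup>2) * E lam u) ?N"
    using has_vector_derivative_mult[OF has_vector_derivative_add[OF A2
        has_vector_derivative_mult[OF has_vector_derivative_mult_right[OF A1, of ?s] \<Phi>2]] E]
    by (simp add: algebra_simps power2_eq_square)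
  ultimately show "(geometrical_term \<Phi> A lam has_vector_derivative (A' u + ?s * A u * \<Phi>' u) * E lam u) ?N \<and>
      ((\<lambda>u. (A' u + ?s * A u * \<Phi>' u) * E lam u) has_vector_derivative
      (A'' u + ?s * (2 * A' u * \<Phi>' u + A u * \<Phi>'' u) + ?s\<^sup>2 * A u * (\<Phi>' u)\<^sup>2) * E lam u) ?N"
    by simp
qed

text \<open>A polynomial with vanishing coefficients is zero, so the term solves the Helmholtz
  equation exactly for every \<open>lam\<close>. Conversely, an exact solution admits the zero
  polynomial as its substitution polynomial.\<close>

lemma geometrical_equations_iff:
  "geometrical_equations \<Phi> A \<longleftrightarrow>
     (\<forall>lam. helmholtz beltrami_domain beltrami_metric (lam\<^sup>2 + 1/4)
        (\<lambda>q. geometrical_term \<Phi> A lam (fst q)))"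
proof -
  have vanishing: "substitution_polynomial \<Phi> A P \<longleftrightarrow>
     (\<forall>lam. helmholtz beltrami_domain beltrami_metric (lam\<^sup>2 + 1/4)
        (\<lambda>q. geometrical_term \<Phi> A lam (fst q)))"
    if P: "\<And>p. p \<in> beltrami_domain \<Longrightarrow> P p = 0" for P
    by (simp only: substitution_polynomial_def helmholtz_def P poly_0 mult_zero_left cong: ball_cong)
  show ?thesis
  proof
    assume "geometrical_equations \<Phi> A"
    then obtain P where P: "substitution_polynomial \<Phi> A P"
      "\<forall>p\<in>beltrami_domain. \<forall>j. coeff (P p) j = 0"
      unfolding geometrical_equations_def by blast
    have "P p = 0" if "p \<in> beltrami_domain" for p
      by (rule poly_eqI) (use P(2) that in simp)
    with P(1) vanishing show "\<forall>lam. helmholtz beltrami_domain beltrami_metric (lam\<^sup>2 + 1/4)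
        (\<lambda>q. geometrical_term \<Phi> A lam (fst q))" by blast
  next
    assume "\<forall>lam. helmholtz beltrami_domain beltrami_metric (lam\<^sup>2 + 1/4)
        (\<lambda>q. geometrical_term \<Phi> A lam (fst q))"
    then show "geometrical_equations \<Phi> A"
      unfolding geometrical_equations_def
      by (intro exI[of _ "\<lambda>_. 0"] conjI ballI allI) (auto simp only: vanishing coeff_0)
  qed
qed

lemma geometrical_equations_expanded:
  assumes \<Phi>: "has_derivatives2 \<Phi> \<Phi>' \<Phi>''" and A: "has_derivatives2 A A' A''"
  shows "geometrical_equations \<Phi> A \<longleftrightarrow>
    (\<forall>lam. \<forall>u\<ge>0. A'' u - A' u + (1/2 - \<i> * of_real lam) * (2 * A' u * \<Phi>' u + A u * \<Phi>'' u - A u * \<Phi>' u)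
       + (1/2 - \<i> * of_real lam)\<^sup>2 * (A u * (\<Phi>' u)\<^sup>2) + of_real (lam\<^sup>2 + 1/4) * A u = 0)"
    (is "_ = (\<forall>lam. \<forall>u\<ge>0. ?e lam u = 0)")
proof -
  have "laplace_beltrami beltrami_domain beltrami_metric (\<lambda>q. geometrical_term \<Phi> A lam (fst q)) p
      + of_real (lam\<^sup>2 + 1/4) * geometrical_term \<Phi> A lam (fst p)
    = ?e lam (fst p) * exp ((1/2 - \<i> * of_real lam) * of_real (\<Phi> (fst p)))"
    if "p \<in> beltrami_domain" for p lam
    unfolding laplace_beltrami_beltrami_fst[OF has_derivatives2_geometrical_term[OF \<Phi> A] that]
    unfolding geometrical_term_def by algebra
  then have "geometrical_equations \<Phi> A \<longleftrightarrow> (\<forall>lam. \<forall>p\<in>beltrami_domain. ?e lam (fst p) = 0)"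
    by (simp only: geometrical_equations_iff helmholtz_def mult_eq_0_iff exp_not_eq_zero simp_thms
        cong: ball_cong)
  then show ?thesis by (auto simp: beltrami_domain_def)
qed

subsection \<open>Eikonal and transport equations\<close>

lemma constant_on_half_line:
  assumes "\<And>u. u \<ge> 0 \<Longrightarrow> (f has_vector_derivative 0) (at u within {0..})"
  obtains c where "\<And>u::real. u \<ge> 0 \<Longrightarrow> f u = c"
  using has_vector_derivative_zero_constant[of "{0..}" f] assms by auto

lemma exponential_on_half_line:
  fixes f :: "real \<Rightarrow> complex"
  assumes "\<And>u. u \<ge> 0 \<Longrightarrow> (f has_vector_derivative of_real r * f u) (at u within {0..})"
  obtains c where "\<And>u. u \<ge> 0 \<Longrightarrow> f u = c * exp (of_real (r * u))"
proof -
  \<comment> \<open>Multiplication by the integrating factor makes the function constant.\<close>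
  have "((\<lambda>t. exp (- (r * t)) *\<^sub>R f t) has_vector_derivative 0) (at u within {0..})" if "u \<ge> 0" for u
  proof -
    have "((\<lambda>t. exp (- (r * t)) *\<^sub>R f t) has_vector_derivative
        exp (- (r * u)) *\<^sub>R (of_real r * f u) + (- r * exp (- (r * u))) *\<^sub>R f u) (at u within {0..})"
      using assms[OF that] by (intro has_vector_derivative_scaleR) (auto intro!: derivative_eq_intros)
    then show ?thesis by (simp add: scaleR_conv_of_real algebra_simps)
  qed
  then obtain c where c: "exp (- (r * u)) *\<^sub>R f u = c" if "u \<ge> 0" for u
    using constant_on_half_line[of "\<lambda>t. exp (- (r * t)) *\<^sub>R f t"] by metis
  have "f u = c * exp (of_real (r * u))" if "u \<ge> 0" for u
  proof -
    have "f u = (exp (- (r * u)) * exp (r * u)) *\<^sub>R f u" by (simp flip: exp_add)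
    also have "\<dots> = (exp (- (r * u)) *\<^sub>R f u) * of_real (exp (r * u))"
      by (simp add: scaleR_conv_of_real mult_ac)
    finally show ?thesis by (simp only: c[OF that] exp_of_real)
  qed
  then show thesis by (rule that)
qed

text \<open>The equation is quadratic in \<open>lam\<close>, so the values 0, 1 and -1 determine its
  three coefficients.\<close>

lemma geometrical_equations_coefficients:
  assumes eqs: "geometrical_equations \<Phi> A"
    and \<Phi>: "has_derivatives2 \<Phi> \<Phi>' \<Phi>''" and A: "has_derivatives2 A A' A''" and u: "u \<ge> 0"
  shows "A u * (\<Phi>' u)\<^sup>2 = A u"
    and "2 * A' u * \<Phi>' u + A u * \<Phi>'' u - A u * \<Phi>' u = - A u"
    and "A'' u = A' u"
proof -
  define X Y Z where "X = A'' u - A' u" and "Y = 2 * A' u * \<Phi>' u + A u * \<Phi>'' u - A u * \<Phi>' u"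
    and "Z = A u * (\<Phi>' u)\<^sup>2"
  have e: "X + (1/2 - \<i> * of_real lam) * Y + (1/2 - \<i> * of_real lam)\<^sup>2 * Z
      + of_real (lam\<^sup>2 + 1/4) * A u = 0" for lam
    using eqs u unfolding geometrical_equations_expanded[OF \<Phi> A] X_def Y_def Z_def by blast
  have e0: "X + Y / 2 + Z / 4 + A u / 4 = 0"
    using e[of 0] by (simp add: power2_eq_square)
  have e1: "X + (1/2 - \<i>) * Y + (- 3/4 - \<i>) * Z + 5/4 * A u = 0"
    using e[of 1] by (simp add: power2_eq_square algebra_simps)
  have e2: "X + (1/2 + \<i>) * Y + (- 3/4 + \<i>) * Z + 5/4 * A u = 0"
    using e[of "-1"] by (simp add: power2_eq_square algebra_simps)
  \<comment> \<open>The difference of the equations at -1 and 1 isolates the odd part in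
    \<open>lam\<close>; their sum, compared with the equation at 0, isolates the quadratic
    part.\<close>
  have "2 * \<i> * (Y + Z) = 0"
    using arg_cong2[OF e2 e1, of minus] by (simp add: algebra_simps)
  then have YZ: "Y = - Z" by (simp add: eq_neg_iff_add_eq_0)
  have "2 * X + Y - 3/2 * Z + 5/2 * A u = 0"
    using arg_cong2[OF e2 e1, of plus] by (simp add: algebra_simps)
  with e0 YZ have ZA: "Z = A u" by algebra
  then show "A u * (\<Phi>' u)\<^sup>2 = A u" "2 * A' u * \<Phi>' u + A u * \<Phi>'' u - A u * \<Phi>' u = - A u"
    using YZ by (simp_all add: Y_def Z_def)
  show "A'' u = A' u" using e0 YZ ZA by (simp add: X_def)
qed

text \<open>At a zero of the amplitude, differentiating the eikonal equation \<open>A \<Phi>'\<^sup>2 = A\<close> gives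
  \<open>A' (\<Phi>'\<^sup>2 - 1) = 0\<close> and the transport equation gives \<open>A' \<Phi>' = 0\<close>; hence \<open>A' = 0\<close>, and
  \<open>A'' = A'\<close> forces \<open>A\<close> to vanish identically.\<close>

lemma geometrical_amplitude_nonzero:
  assumes eqs: "geometrical_equations \<Phi> A"
    and \<Phi>: "has_derivatives2 \<Phi> \<Phi>' \<Phi>''" and A: "has_derivatives2 A A' A''"
    and nz: "\<exists>u\<ge>0. A u \<noteq> 0" and u: "u \<ge> 0"
  shows "A u \<noteq> 0"
proof
  assume z: "A u = 0"
  note co = geometrical_equations_coefficients[OF eqs \<Phi> A]
  let ?N = "at u within {0..}"
  have \<Phi>2: "((\<lambda>t. complex_of_real (\<Phi>' t)) has_vector_derivative \<Phi>'' u) ?N"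
    using \<Phi> u unfolding has_derivatives2_def
    by (auto intro!: has_vector_derivative_of_real simp: has_real_derivative_iff_has_vector_derivative)
  have A1: "(A has_vector_derivative A' u) ?N" using A u by (auto simp: has_derivatives2_def)
  have "((\<lambda>t. A t * (\<Phi>' t * \<Phi>' t) - A t) has_vector_derivative A' u * (\<Phi>' u * \<Phi>' u) - A' u) ?N"
    using has_vector_derivative_diff[OF has_vector_derivative_mult[OF A1
        has_vector_derivative_mult[OF \<Phi>2 \<Phi>2]] A1] z by simp
  moreover have "((\<lambda>t. A t * (\<Phi>' t * \<Phi>' t) - A t) has_vector_derivative 0) ?N"
    by (rule has_vector_derivative_transform[OF _ _ has_vector_derivative_const[of 0]])
       (use u co(1) in \<open>auto simp: power2_eq_square\<close>)
  ultimately have "A' u * (\<Phi>' u * \<Phi>' u) - A' u = 0"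
    by (rule vector_derivative_unique_within[OF at_within_atLeast_neq_bot[OF u]])
  moreover have "A' u * \<Phi>' u = 0" using co(2)[OF u] z by simp
  ultimately have A'u: "A' u = 0" by auto
  have "(A' has_vector_derivative of_real 1 * A' t) (at t within {0..})" if "t \<ge> 0" for t
    using A that co(3)[OF that] by (auto simp: has_derivatives2_def)
  then obtain c where c: "A' t = c * exp (of_real (1 * t))" if "t \<ge> 0" for t
    using exponential_on_half_line[of A' 1] by blast
  have "c = 0" using c[OF u] A'u by simp
  then have "(A has_vector_derivative 0) (at t within {0..})" if "t \<ge> 0" for t
    using A c[OF that] that unfolding has_derivatives2_def by auto
  then obtain d where "A t = d" if "t \<ge> 0" for t
    using constant_on_half_line[of A] by blast
  with z u nz show False by auto
qed

lemma geometrical_equations_imp: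
  assumes eqs: "geometrical_equations \<Phi> A"
    and C2: "C2_on beltrami_domain (\<lambda>p. \<Phi> (fst p))" "C2_on beltrami_domain (\<lambda>p. A (fst p))"
    and nz: "\<exists>u\<ge>0. A u \<noteq> 0"
  obtains \<sigma> \<kappa> :: real and a where "\<sigma> \<in> {1, -1}" "\<And>u. u \<ge> 0 \<Longrightarrow> \<Phi> u = \<sigma> * u + \<kappa>"
    "\<And>u. u \<ge> 0 \<Longrightarrow> A u = a * exp (of_real ((1 - \<sigma>) / 2 * u))"
proof -
  obtain \<Phi>' \<Phi>'' where \<Phi>: "has_derivatives2 \<Phi> \<Phi>' \<Phi>''"
    using C2(1) by (rule C2_on_fst_imp_has_derivatives2)
  obtain A' A'' where A: "has_derivatives2 A A' A''"
    using C2(2) by (rule C2_on_fst_imp_has_derivatives2)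
  note co = geometrical_equations_coefficients[OF eqs \<Phi> A]
  note A0 = geometrical_amplitude_nonzero[OF eqs \<Phi> A nz]
  have sq: "\<Phi>' u = 1 \<or> \<Phi>' u = -1" if "u \<ge> 0" for u
  proof -
    have "complex_of_real ((\<Phi>' u)\<^sup>2) = of_real 1" using co(1)[OF that] A0[OF that] by simp
    then show ?thesis unfolding of_real_eq_iff by (simp add: power2_eq_1_iff)
  qed
  \<comment> \<open>A continuous function with values in a finite set is constant on a connected
    set, so the sign cannot change along the half-line.\<close>
  have "continuous_on {0..} \<Phi>'"
    using \<Phi> unfolding has_derivatives2_def by (auto intro!: continuous_on_vector_derivative)
  moreover have "finite (\<Phi>' ` {0..})" by (rule finite_subset[of _ "{1, -1}"]) (use sq in auto)
  ultimately have "\<Phi>' constant_on {0..}"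
    by (intro continuous_finite_range_constant) auto
  then obtain \<sigma> where \<sigma>: "\<Phi>' u = \<sigma>" if "u \<ge> 0" for u
    unfolding constant_on_def by auto
  have \<sigma>1: "\<sigma> \<in> {1, -1}" using sq[of 0] \<sigma>[of 0] by simp
  have \<Phi>''0: "\<Phi>'' u = 0" if u: "u \<ge> 0" for u
  proof (rule vector_derivative_unique_within[OF at_within_atLeast_neq_bot[OF u]])
    show "(\<Phi>' has_vector_derivative \<Phi>'' u) (at u within {0..})"
      using \<Phi> u by (simp add: has_derivatives2_def)
    show "(\<Phi>' has_vector_derivative 0) (at u within {0..})"
      by (rule has_vector_derivative_transform[OF _ _ has_vector_derivative_const]) (use u \<sigma> in auto)
  qed
  have "((\<lambda>t. \<Phi> t - \<sigma> * t) has_vector_derivative 0) (at u within {0..})" if "u \<ge> 0" for u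
  proof -
    have "(\<Phi> has_vector_derivative \<sigma>) (at u within {0..})"
      using \<Phi> \<sigma>[OF that] that by (auto simp: has_derivatives2_def)
    from has_vector_derivative_diff[OF this has_vector_derivative_mult_right[OF has_vector_derivative_id, of \<sigma>]]
    show ?thesis by (auto simp: id_def)
  qed
  then obtain \<kappa> where \<kappa>: "\<Phi> u - \<sigma> * u = \<kappa>" if "u \<ge> 0" for u
    using constant_on_half_line[of "\<lambda>t. \<Phi> t - \<sigma> * t"] by metis
  have "(A has_vector_derivative of_real ((1 - \<sigma>) / 2) * A u) (at u within {0..})" if u: "u \<ge> 0" for u
  proof -
    \<comment> \<open>The transport equation now reads
      \<open>2 * \<sigma> * A' u = (\<sigma> - 1) * A u\<close>, that is, \<open>A' = 0\<close> for
      \<open>\<sigma> = 1\<close> and \<open>A' = A\<close> for \<open>\<sigma> = -1\<close>; the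
      factor \<open>(1 - \<sigma>) / 2\<close> covers both.\<close>
    have "A' u = of_real ((1 - \<sigma>) / 2) * A u"
      using co(2)[OF u] \<sigma>1 \<sigma>[OF u] \<Phi>''0[OF u] by auto
    then show ?thesis using A u unfolding has_derivatives2_def by metis
  qed
  then obtain a where "A u = a * exp (of_real ((1 - \<sigma>) / 2 * u))" if "u \<ge> 0" for u
    using exponential_on_half_line[of A "(1 - \<sigma>) / 2"] by blast
  moreover have "\<Phi> u = \<sigma> * u + \<kappa>" if "u \<ge> 0" for u using \<kappa>[OF that] by simp
  ultimately show thesis using \<sigma>1 that by blast
qed

section \<open>Form and existence of the geometrical approximation\<close>

text \<open>The real exponents add up to \<open>(1 - \<sigma>) / 2 + \<sigma> / 2 = 1 / 2\<close>,
  which is why the growth exp(u/2) is the same for both signs. The phase constant splits off as a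
  factor free of \<open>u\<close>.\<close>

lemma geometrical_term_linear_phase:
  assumes "\<Phi> u = \<sigma> * u + \<kappa>" "A u = a * exp (of_real ((1 - \<sigma>) / 2 * u))"
  shows "geometrical_term \<Phi> A lam u = a * exp ((1/2 - \<i> * of_real lam) * of_real \<kappa>)
    * exp (of_real (u / 2)) * exp (- (of_real \<sigma> * \<i> * of_real lam * of_real u))"
  unfolding geometrical_term_def assms
  by (simp add: mult.assoc flip: exp_add) (simp add: field_simps)

lemma geometrical_equations_linear_phase:
  fixes \<sigma> \<kappa> :: real
  assumes "\<sigma> \<in> {1, -1}"
  defines "\<Phi> \<equiv> \<lambda>u. \<sigma> * u + \<kappa>" and "A \<equiv> \<lambda>u. exp (complex_of_real ((1 - \<sigma>) / 2 * u))"
  shows "C2_on beltrami_domain (\<lambda>p. \<Phi> (fst p))" "C2_on beltrami_domain (\<lambda>p. A (fst p))"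
    "geometrical_equations \<Phi> A"
proof -
  let ?r = "(1 - \<sigma>) / 2"
  have \<Phi>: "has_derivatives2 \<Phi> (\<lambda>_. \<sigma>) (\<lambda>_. 0)"
    unfolding has_derivatives2_def \<Phi>_def
    by (auto simp flip: has_real_derivative_iff_has_vector_derivative intro!: derivative_eq_intros)
  have dA: "(A has_vector_derivative of_real ?r * A u) (at u within {0..})" for u
    unfolding A_def
    by (intro has_vector_derivative_exp has_vector_derivative_of_real) (auto intro!: derivative_eq_intros)
  have A: "has_derivatives2 A (\<lambda>u. of_real ?r * A u) (\<lambda>u. of_real ?r * (of_real ?r * A u))"
    unfolding has_derivatives2_def by (intro allI impI conjI has_vector_derivative_mult_right dA)
  show "C2_on beltrami_domain (\<lambda>p. \<Phi> (fst p))"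
    by (rule has_derivatives2_imp_C2_on_fst[OF \<Phi>]) simp
  show "C2_on beltrami_domain (\<lambda>p. A (fst p))"
    by (rule has_derivatives2_imp_C2_on_fst[OF A]) (auto simp: A_def intro!: continuous_intros)
  show "geometrical_equations \<Phi> A"
    unfolding geometrical_equations_expanded[OF \<Phi> A]
    \<comment> \<open>The rate \<open>(1 - \<sigma>) / 2\<close> is 0 or 1, hence equal to its
      square, which gives \<open>A'' = A'\<close>.\<close>
    using assms(1) by (auto simp: power2_eq_square field_simps)
qed

lemma geometrical_approximation_form:
  assumes "geometrical_approximation w \<Phi> T"
  shows "\<exists>\<sigma>\<in>{1, -1}. \<exists>\<kappa> C. (\<forall>u\<ge>0. \<Phi> u = \<sigma> * u + \<kappa>) \<and>
           (\<forall>lam. \<forall>u\<ge>0. T lam u =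
              C lam * exp (of_real (u / 2)) * exp (- (of_real \<sigma> * \<i> * of_real lam * of_real u)))"
proof -
  obtain c A where C2: "C2_on beltrami_domain (\<lambda>p. \<Phi> (fst p))" "C2_on beltrami_domain (\<lambda>p. A (fst p))"
    and nz: "\<exists>u\<ge>0. A u \<noteq> 0" and eqs: "geometrical_equations \<Phi> A"
    and T: "\<And>lam u. u \<ge> 0 \<Longrightarrow> T lam u = c lam * geometrical_term \<Phi> A lam u"
    using assms unfolding geometrical_approximation_def by blast
  obtain \<sigma> \<kappa> :: real and a where \<sigma>: "\<sigma> \<in> {1, -1}"
    and \<Phi>: "\<And>u. u \<ge> 0 \<Longrightarrow> \<Phi> u = \<sigma> * u + \<kappa>"
    and A: "\<And>u. u \<ge> 0 \<Longrightarrow> A u = a * exp (of_real ((1 - \<sigma>) / 2 * u))"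
    using geometrical_equations_imp[OF eqs C2 nz] by blast
  \<comment> \<open>All factors free of \<open>u\<close>, from the amplitude and from the phase
    constant, are absorbed here.\<close>
  define C where "C = (\<lambda>lam. c lam * (a * exp ((1/2 - \<i> * of_real lam) * of_real \<kappa>)))"
  have "T lam u = C lam * exp (of_real (u / 2)) * exp (- (of_real \<sigma> * \<i> * of_real lam * of_real u))"
    if "u \<ge> 0" for lam u
    unfolding T[OF that] geometrical_term_linear_phase[of \<Phi> u \<sigma> \<kappa> A a, OF \<Phi>[OF that] A[OF that]] C_def
    by (simp only: mult.assoc)
  with \<sigma> \<Phi> show ?thesis by blast
qed

text \<open>The phase \<open>- u + \<kappa>\<close> comes from the horocyclic wave of spectral parameter \<open>- lam\<close>.\<close>

lemma geometrical_approximation_exists: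
  fixes b :: "real option" and \<sigma> \<kappa> h :: real and C :: "real \<Rightarrow> complex"
  assumes \<sigma>: "\<sigma> \<in> {1, -1}" and h: "h > 0"
  defines "T \<equiv> \<lambda>lam u. C lam * exp (of_real (u / 2)) * exp (- (of_real \<sigma> * \<i> * of_real lam * of_real u))"
  defines "\<psi> \<equiv> \<lambda>lam p. C lam * horocyclic_wave b h (\<sigma> * lam) p"
  shows "wave_function lam (\<psi> lam)" "in_beltrami_coordinates b h \<psi> T"
    "geometrical_approximation T (\<lambda>u. \<sigma> * u + \<kappa>) T"
proof -
  \<comment> \<open>The Helmholtz equation sees the spectral parameter only through its
    square.\<close>
  have "(\<sigma> * lam)\<^sup>2 = lam\<^sup>2" using \<sigma> by auto
  then show "wave_function lam (\<psi> lam)"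
    using wave_function_horocyclic_wave[OF h, of "\<sigma> * lam"]
    unfolding wave_function_def \<psi>_def by simp
  show "in_beltrami_coordinates b h \<psi> T"
    unfolding in_beltrami_coordinates_def \<psi>_def T_def horocyclic_wave_def
    by (auto simp: horo_coordinate_beltrami_chart[OF h] mult.assoc simp flip: exp_add)
       (simp add: algebra_simps)
  define A where "A = (\<lambda>u. exp (complex_of_real ((1 - \<sigma>) / 2 * u)))"
  \<comment> \<open>The second factor cancels the one that \<open>\<kappa>\<close> contributes to
    the geometrical term, so the same \<open>T\<close> serves every phase constant.\<close>
  define c where "c = (\<lambda>lam. C lam * exp (- ((1/2 - \<i> * of_real lam) * of_real \<kappa>)))"
  have linear: "C2_on beltrami_domain (\<lambda>p. A (fst p))"
    unfolding A_def by (rule geometrical_equations_linear_phase[OF \<sigma>])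
  have T: "T lam u = c lam * geometrical_term (\<lambda>u. \<sigma> * u + \<kappa>) A lam u" for lam u
  proof -
    let ?x = "(1/2 - \<i> * of_real lam) * complex_of_real \<kappa>"
    have g: "geometrical_term (\<lambda>u. \<sigma> * u + \<kappa>) A lam u = 1 * exp ?x
        * exp (of_real (u / 2)) * exp (- (of_real \<sigma> * \<i> * of_real lam * of_real u))"
      by (rule geometrical_term_linear_phase) (simp_all add: A_def)
    have "exp (- ?x) * exp ?x = 1" by (simp flip: exp_add)
    then show ?thesis unfolding T_def c_def g by algebra
  qed
  show "geometrical_approximation T (\<lambda>u. \<sigma> * u + \<kappa>) T"
    unfolding geometrical_approximation_def
  \<comment> \<open>The wave equals its leading term, so the asymptotic equivalence is
    reflexivity.\<close>
  proof (intro conjI)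
    have "\<exists>u\<ge>0. A u \<noteq> 0" by (auto simp: A_def)
    with linear geometrical_equations_linear_phase(1,3)[OF \<sigma>, folded A_def] T
    show "\<exists>c A. C2_on beltrami_domain (\<lambda>p. \<sigma> * fst p + \<kappa>) \<and>
        C2_on beltrami_domain (\<lambda>p. A (fst p)) \<and> (\<exists>u\<ge>0. A u \<noteq> 0) \<and>
        geometrical_equations (\<lambda>u. \<sigma> * u + \<kappa>) A \<and>
        (\<forall>lam. \<forall>u\<ge>0. T lam u = c lam * geometrical_term (\<lambda>u. \<sigma> * u + \<kappa>) A lam u)"
      by (metis (no_types, lifting))
  qed simp
qed

text \<open>The second conjunct shows that the constant in the Helmholtz equation is forced; the
  fourth realises every sign, phase constant and factor \<open>C\<close>, so the third is not
  vacuous.\<close>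

theorem proposition4:
  shows
    "(\<forall>lam \<psi>. wave_function lam \<psi> \<longleftrightarrow>
        C2_on half_plane \<psi> \<and>
        (\<forall>p\<in>half_plane. hyperbolic_laplacian \<psi> p + of_real (lam\<^sup>2 + 1/4) * \<psi> p = 0))
     \<and>
     (\<forall>(lam::real) b h k2. h > 0 \<longrightarrow>
        (helmholtz half_plane hyperbolic_metric k2 (horocyclic_wave b h lam) \<longleftrightarrow> k2 = lam\<^sup>2 + 1/4))
     \<and>
     (\<forall>b h \<psi> w \<Phi> T.
        h > 0 \<and> (\<forall>lam. wave_function lam (\<psi> lam)) \<and> in_beltrami_coordinates b h \<psi> w \<and>
        geometrical_approximation w \<Phi> T \<longrightarrow>
        (\<exists>\<sigma>\<in>{1, -1}. \<exists>\<kappa> C. (\<forall>u\<ge>0. \<Phi> u = \<sigma> * u + \<kappa>) \<and>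
           (\<forall>lam. \<forall>u\<ge>0. T lam u =
              C lam * exp (of_real (u / 2)) * exp (- (of_real \<sigma> * \<i> * of_real lam * of_real u)))))
     \<and>
     (\<forall>b h C \<kappa>. \<forall>\<sigma>\<in>{1, -1}. h > 0 \<longrightarrow>
        (\<exists>\<psi> w. (\<forall>lam. wave_function lam (\<psi> lam)) \<and> in_beltrami_coordinates b h \<psi> w \<and>
           geometrical_approximation w (\<lambda>u. \<sigma> * u + \<kappa>)
             (\<lambda>lam u. C lam * exp (of_real (u / 2)) *
                exp (- (of_real \<sigma> * \<i> * of_real lam * of_real u)))))"
proof (intro conjI allI impI ballI)
  fix b C and \<sigma> \<kappa> h :: real
  assume "\<sigma> \<in> {1, -1}" "h > 0"
  note ex = geometrical_approximation_exists[OF this]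
  show "\<exists>\<psi> w. (\<forall>lam. wave_function lam (\<psi> lam)) \<and> in_beltrami_coordinates b h \<psi> w \<and>
      geometrical_approximation w (\<lambda>u. \<sigma> * u + \<kappa>)
        (\<lambda>lam u. C lam * exp (of_real (u / 2)) *
           exp (- (of_real \<sigma> * \<i> * of_real lam * of_real u)))"
    \<comment> \<open>The witness for \<open>w\<close> stays schematic until \<open>ex(2)\<close>
      fixes it as the approximating expression itself.\<close>
    by (intro exI[of _ "\<lambda>lam p. C lam * horocyclic_wave b h (\<sigma> * lam) p"] exI conjI allI)
       (rule ex(1), rule ex(2), rule ex(3))
qed (use wave_function_iff helmholtz_horocyclic_wave_iff geometrical_approximation_form in blast)+

end
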